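(* Let $T_1$ and $T_2$ be finitely generated, commutative, reduced and cancellative semigroups with zero, minimally generated by $A_1=\{a_1,\dots,a_r\}$ and $A_2=\{b_1,\dots,b_t\}$ respectively, such that $I_{T_1}$ and $I_{T_2}$ are nontrivial proper ideals of their polynomial rings. Let $L_1$ and $L_2$ be integer matrices whose rows form a basis of $\ker T_1\subset\mathbb{Z}^r$ and $\ker T_2\subset\mathbb{Z}^t$ respectively, let $\gamma_X\in\mathbb{N}^r$ and $\gamma_Y\in\mathbb{N}^t$ be nonzero, and let $$A=\left(\begin{array}{c|c} L_1&0\\ \hline 0&L_2\\ \hline \gamma_X&-\gamma_Y\end{array}\right).$$ Let $S=\langle B_1,B_2\rangle$ be a commutative cancellative semigroup with zero, generated by families $B_1$ of $r$ elements and $B_2$ of $t$ elements, such that $\ker(\langle B_1,B_2\rangle)\subset\mathbb{Z}^{r+t}$ is the lattice generated by the rows of $A$. If $$\sum_{i=1}^r\gamma_{Xi}>1\quad\text{and}\quad \sum_{i=1}^t\gamma_{Yi}>1,$$ then $S$ is a glued semigroup.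
   Context: A semigroup $T$ is cancellative if $m+n=m+n'$ implies $n=n'$ (so it embeds in a commutative group $G(T)$), and reduced if $T\cap(-T)=\{0\}$. "Minimally generated" means no proper subset of the generating set generates the semigroup. For a semigroup $T$ with an ordered generating family $(n_1,\dots,n_l)$, $\ker T=\{\alpha\in\mathbb{Z}^l\mid\sum_{i=1}^l\alpha_i n_i=0\}$. For a field $\Bbbk$, the semigroup ideal $I_T\subset\Bbbk[X_1,\dots,X_l]$ is the ideal generated by all $X^\alpha-X^\beta$ with $\sum\alpha_in_i=\sum\beta_in_i$. For $\langle B_1,B_2\rangle$, the generators are ordered with those of $B_1$ first and then those of $B_2$. Definition (gluing). Let $S$ be a finitely generated, commutative, reduced, cancellative semigroup with zero, minimally generated by a disjoint union $E_1\sqcup E_2$ of nonempty sets with $|E_1|=r$, $|E_2|=t$, and let $\Bbbk[X_1,\dots,X_r,Y_1,\dots,Y_t]$ have the $X$'s corresponding to $E_1$ and the $Y$'s to $E_2$. $S$ is the gluing of $S_1=\langle E_1\rangle$ and $S_2=\langle E_2\rangle$ if there is a nonzero binomial $X^{\gamma}-Y^{\gamma'}\in I_S$ such that $I_S=I_{S_1}+I_{S_2}+\langle X^{\gamma}-Y^{\gamma'}\rangle$. A semigroup is a glued semigroup if it is the gluing of two semigroups in this sense. *)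

theory Defs
  imports
    "HOL-Library.Poly_Mapping"
    "HOL-Algebra.Ideal"
    "Jordan_Normal_Form.VS_Connect"
begin

section \<open>Commutative semigroups with zero\<close>

text \<open>
  A commutative semigroup with zero is a subset of an arbitrary type of class
  \<^class>\<open>comm_monoid_add\<close> that contains 0 and is closed under addition.  The ambient
  type need not be cancellative.
\<close>

definition add_submonoid :: "'a::comm_monoid_add set \<Rightarrow> bool" where
  "add_submonoid T \<longleftrightarrow> 0 \<in> T \<and> (\<forall>x\<in>T. \<forall>y\<in>T. x + y \<in> T)"

definition generated :: "'a::comm_monoid_add set \<Rightarrow> 'a set" where
  "generated A = add_submonoid hull A"

definition minimally_generates :: "'a::comm_monoid_add set \<Rightarrow> 'a set \<Rightarrow> bool" where
  "minimally_generates A T \<longleftrightarrow> generated A = T \<and> (\<forall>A'. A' \<subset> A \<longrightarrow> generated A' \<noteq> T)"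

definition finitely_generated :: "'a::comm_monoid_add set \<Rightarrow> bool" where
  "finitely_generated T \<longleftrightarrow> (\<exists>F. finite F \<and> generated F = T)"

definition cancellative :: "'a::comm_monoid_add set \<Rightarrow> bool" where
  "cancellative T \<longleftrightarrow> (\<forall>m\<in>T. \<forall>n\<in>T. \<forall>n'\<in>T. m + n = m + n' \<longrightarrow> n = n')"

text \<open>\<open>T \<inter> (-T)\<close> is the set of elements of \<open>T\<close> that have an additive inverse in \<open>T\<close>.\<close>

definition reduced :: "'a::comm_monoid_add set \<Rightarrow> bool" where
  "reduced T \<longleftrightarrow> {x \<in> T. \<exists>y\<in>T. x + y = 0} = {0}"

definition nat_scale :: "nat \<Rightarrow> 'a::comm_monoid_add \<Rightarrow> 'a" where
  "nat_scale k x = (\<Sum>_<k. x)"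

text \<open>
  The integer relations \<open>\<Sum>i. \<alpha> i * n i = 0\<close> among the members of the ordered family
  \<open>ns\<close>.  For a cancellative semigroup this is an equation in its group of differences,
  into which the semigroup embeds; moving the negative terms to the right hand side turns
  it into an equation in the semigroup itself.
\<close>

definition relation_kernel :: "'a::comm_monoid_add list \<Rightarrow> int vec set" where
  "relation_kernel ns = {\<alpha> \<in> carrier_vec (length ns).
     (\<Sum>i<length ns. nat_scale (nat (\<alpha> $ i)) (ns ! i)) =
     (\<Sum>i<length ns. nat_scale (nat (- (\<alpha> $ i))) (ns ! i))}"

section \<open>Polynomial rings and semigroup ideals\<close>

text \<open>
  Monomials are finitely supported exponent functions.  \<open>poly_ring V\<close> is the ring
  of polynomials whose variables are indexed by \<open>V\<close>, so that \<open>V \<subseteq> W\<close> gives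
  an inclusion of rings.
\<close>

type_synonym ('v, 'k) mpoly = "('v \<Rightarrow>\<^sub>0 nat) \<Rightarrow>\<^sub>0 'k"

definition poly_ring :: "'v set \<Rightarrow> ('v, 'k::field) mpoly ring" where
  "poly_ring V = \<lparr>carrier = {p. \<forall>m \<in> Poly_Mapping.keys p. Poly_Mapping.keys m \<subseteq> V},
     monoid.mult = (*), one = 1, zero = 0, add = (+)\<rparr>"

lemma poly_ring_simps [simp]:
  "carrier (poly_ring V) = {p. \<forall>m \<in> Poly_Mapping.keys p. Poly_Mapping.keys m \<subseteq> V}"
  "monoid.mult (poly_ring V) = (*)" "one (poly_ring V) = 1"
  "zero (poly_ring V) = 0" "add (poly_ring V) = (+)"
  by (simp_all add: poly_ring_def)

lemma poly_ring_mult_closed: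
  fixes p q :: "('v, 'k::field) mpoly"
  assumes "p \<in> carrier (poly_ring V)" "q \<in> carrier (poly_ring V)"
  shows "p * q \<in> carrier (poly_ring V)"
proof -
  have "Poly_Mapping.keys m \<subseteq> V" if m: "m \<in> Poly_Mapping.keys (p * q)" for m
  proof -
    have "m \<in> {a + b | a b. a \<in> Poly_Mapping.keys p \<and> b \<in> Poly_Mapping.keys q}"
      using keys_mult[of p q] m by (rule subsetD)
    then obtain a b where ab: "m = a + b" "a \<in> Poly_Mapping.keys p" "b \<in> Poly_Mapping.keys q"
      by blast
    have "Poly_Mapping.keys a \<subseteq> V" "Poly_Mapping.keys b \<subseteq> V"
      using ab(2,3) assms by auto
    then show ?thesis using Poly_Mapping.keys_add[of a b] ab(1) by blast
  qed
  then show ?thesis by simp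
qed

lemma cring_poly_ring: "cring (poly_ring V :: ('v, 'k::field) mpoly ring)"
proof (rule cringI)
  let ?R = "poly_ring V :: ('v, 'k) mpoly ring"
  show "abelian_group ?R"
  proof (rule abelian_groupI)
    fix x y assume "x \<in> carrier ?R" "y \<in> carrier ?R"
    then show "x \<oplus>\<^bsub>?R\<^esub> y \<in> carrier ?R"
      using Poly_Mapping.keys_add[of x y] by auto
  next
    fix x assume "x \<in> carrier ?R"
    then show "\<exists>y\<in>carrier ?R. y \<oplus>\<^bsub>?R\<^esub> x = \<zero>\<^bsub>?R\<^esub>"
      by (intro bexI[of _ "- x"]) auto
  qed (auto simp: add_ac)
  show "Group.comm_monoid ?R"
  proof (rule comm_monoidI)
    fix x y assume "x \<in> carrier ?R" "y \<in> carrier ?R"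
    then show "x \<otimes>\<^bsub>?R\<^esub> y \<in> carrier ?R"
      using poly_ring_mult_closed[of x V y] by simp
  qed (auto simp: mult_ac)
qed (auto simp: distrib_right)

definition monomial :: "('v \<Rightarrow>\<^sub>0 nat) \<Rightarrow> ('v, 'k::field) mpoly" where
  "monomial \<alpha> = Poly_Mapping.single \<alpha> 1"

text \<open>\<open>weight n \<alpha>\<close> is the semigroup element \<open>\<Sum>i. \<alpha> i * n i\<close>.\<close>

definition weight :: "('v \<Rightarrow> 'a::comm_monoid_add) \<Rightarrow> ('v \<Rightarrow>\<^sub>0 nat) \<Rightarrow> 'a" where
  "weight n \<alpha> = (\<Sum>i\<in>Poly_Mapping.keys \<alpha>. nat_scale (Poly_Mapping.lookup \<alpha> i) (n i))"

definition semigroup_ideal ::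
    "'k::field itself \<Rightarrow> 'v set \<Rightarrow> ('v \<Rightarrow> 'a::comm_monoid_add) \<Rightarrow> ('v, 'k) mpoly set" where
  "semigroup_ideal K V n = genideal (poly_ring V)
     {monomial \<alpha> - monomial \<beta> | \<alpha> \<beta>. Poly_Mapping.keys \<alpha> \<subseteq> V \<and> Poly_Mapping.keys \<beta> \<subseteq> V \<and>
        weight n \<alpha> = weight n \<beta>}"

section \<open>Gluings\<close>

text \<open>
  The variables are the generators themselves: \<open>poly_ring E1\<close> is the ring in the
  \<open>X\<close>-variables and \<open>poly_ring E2\<close> the ring in the \<open>Y\<close>-variables.  The ideals of the two
  smaller rings are extended to the full ring before they are added.
\<close>

definition is_gluing ::
    "'k::field itself \<Rightarrow> 'a::comm_monoid_add set \<Rightarrow> 'a set \<Rightarrow> 'a set \<Rightarrow> bool" where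
  "is_gluing K S E1 E2 \<longleftrightarrow>
     finitely_generated S \<and> cancellative S \<and> reduced S \<and>
     finite E1 \<and> finite E2 \<and> E1 \<noteq> {} \<and> E2 \<noteq> {} \<and> E1 \<inter> E2 = {} \<and>
     minimally_generates (E1 \<union> E2) S \<and>
     (\<exists>\<gamma> \<gamma>'. Poly_Mapping.keys \<gamma> \<subseteq> E1 \<and> Poly_Mapping.keys \<gamma>' \<subseteq> E2 \<and>
        (let R = (poly_ring (E1 \<union> E2) :: ('a, 'k) mpoly ring);
             f = monomial \<gamma> - monomial \<gamma>'
         in f \<noteq> 0 \<and> f \<in> semigroup_ideal K (E1 \<union> E2) id \<and>
            semigroup_ideal K (E1 \<union> E2) id =
              genideal R (semigroup_ideal K E1 id) <+>\<^bsub>R\<^esub>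
              genideal R (semigroup_ideal K E2 id) <+>\<^bsub>R\<^esub>
              genideal R {f}))"

definition glued_semigroup :: "'k::field itself \<Rightarrow> 'a::comm_monoid_add set \<Rightarrow> bool" where
  "glued_semigroup K S \<longleftrightarrow> (\<exists>E1 E2. is_gluing K S E1 E2)"

section \<open>Lattice bases\<close>

text \<open>Distinctness is required separately, since linear independence is a property of sets.\<close>

definition lattice_basis :: "nat \<Rightarrow> int vec list \<Rightarrow> int vec set \<Rightarrow> bool" where
  "lattice_basis n bs \<Lambda> \<longleftrightarrow> set bs \<subseteq> carrier_vec n \<and> distinct bs \<and>
     \<not> LinearCombinations.module.lin_dep class_ring (module_vec TYPE(int) n) (set bs) \<and>
     vec_module.lattice_of n bs = \<Lambda>"

end

theory Submission
  imports Defs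
begin

text \<open>
  Every relation among \<open>B1 @ B2\<close> is a relation of \<open>T1\<close> plus a relation of \<open>T2\<close> plus a multiple
  \<open>m\<close> of \<open>(\<gamma>X, - \<gamma>Y)\<close>.  A factorization of a generator of \<open>S\<close> thus projects to factorizations in
  \<open>T1\<close> and \<open>T2\<close>; if \<open>m \<noteq> 0\<close>, one of them either expresses a generator by at least two
  generators, because the entries of \<open>\<gamma>X\<close> and \<open>\<gamma>Y\<close> sum to more than one, or expresses 0
  nontrivially.  Both are impossible in a reduced semigroup with a minimal generating family, so
  \<open>m = 0\<close> and the factorization is trivial.  Hence \<open>B1 @ B2\<close> is distinct and minimally generates
  the reduced semigroup \<open>S\<close>.  The same decomposition of the relations splits \<open>I_S\<close> into the
  ideals of the two parts and the binomial of \<open>(\<gamma>X, - \<gamma>Y)\<close>.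
\<close>

section \<open>Natural combinations of a family\<close>

text \<open>Coefficients are attached to positions rather than to elements, so that a repeated
  element counts once for each position. This matters for \<open>B1 @ B2\<close>, whose distinctness
  has to be proved.\<close>

definition combination :: "'a::comm_monoid_add list \<Rightarrow> (nat \<Rightarrow> nat) \<Rightarrow> 'a" where
  "combination ns p = (\<Sum>i<length ns. nat_scale (p i) (ns ! i))"

text \<open>Uniqueness of the factorization of each member, tested position by position. It entails
  distinctness, minimal generation and reducedness, and since it speaks only of equations between
  combinations it can be carried from \<open>as\<close> and \<open>bs\<close> over to
  \<open>B1 @ B2\<close>.\<close>

definition indecomposable :: "'a::comm_monoid_add list \<Rightarrow> bool" where
  "indecomposable ns \<longleftrightarrow> (\<forall>i<length ns. \<forall>p. combination ns p = ns ! i \<longrightarrow>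
     (\<forall>j<length ns. p j = of_bool (j = i)))"

lemma nat_scale_simps [simp]:
  "nat_scale 0 x = 0" "nat_scale (Suc k) x = x + nat_scale k x" "nat_scale k 0 = 0"
  by (simp_all add: nat_scale_def add.commute)

lemma nat_scale_add: "nat_scale (k + l) x = nat_scale k x + nat_scale l x"
  by (induction k) (simp_all add: add_ac)

lemma combination_cong:
  "(\<And>i. i < length ns \<Longrightarrow> p i = q i) \<Longrightarrow> combination ns p = combination ns q"
  by (simp add: combination_def)

lemma combination_add:
  "combination ns (\<lambda>i. p i + q i) = combination ns p + combination ns q"
  by (simp add: combination_def nat_scale_add sum.distrib)

lemma combination_zero [simp]: "combination ns (\<lambda>_. 0) = 0"
  by (simp add: combination_def)

lemma combination_unit:
  assumes "i < length ns"
  shows "combination ns (\<lambda>j. of_bool (j = i)) = ns ! i"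
proof -
  have "combination ns (\<lambda>j. of_bool (j = i)) = (\<Sum>j<length ns. if j = i then ns ! j else 0)"
    unfolding combination_def by (intro sum.cong) auto
  with assms show ?thesis by simp
qed

lemma combination_append:
  "combination (ms @ ns) p = combination ms p + combination ns (\<lambda>j. p (length ms + j))"
proof -
  have "(\<Sum>i<length ms + n. nat_scale (p i) ((ms @ ns) ! i)) =
      (\<Sum>i<length ms. nat_scale (p i) (ms ! i)) +
      (\<Sum>i<n. nat_scale (p (length ms + i)) (ns ! i))" for n
    by (induction n) (simp_all add: add_ac nth_append)
  then show ?thesis by (simp add: combination_def)
qed

lemma nat_scale_closed:
  "add_submonoid T \<Longrightarrow> x \<in> T \<Longrightarrow> nat_scale k x \<in> T"
  by (induction k) (auto simp: add_submonoid_def)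

lemma sum_closed:
  assumes "add_submonoid T" "\<And>i. i \<in> I \<Longrightarrow> f i \<in> T"
  shows "sum f I \<in> T"
  using assms(2)
  by (induction I rule: infinite_finite_induct) (use assms(1) in \<open>auto simp: add_submonoid_def\<close>)

lemma combination_closed:
  assumes "add_submonoid T" "\<And>i. i < length ns \<Longrightarrow> p i > 0 \<Longrightarrow> ns ! i \<in> T"
  shows "combination ns p \<in> T"
  unfolding combination_def
proof (intro sum_closed assms(1))
  fix i assume "i \<in> {..<length ns}"
  then show "nat_scale (p i) (ns ! i) \<in> T"
    using assms nat_scale_closed[of T "ns ! i" "p i"]
    by (cases "p i = 0") (auto simp: add_submonoid_def)
qed

section \<open>Generated submonoids as sets of combinations\<close>

lemma add_submonoid_generated: "add_submonoid (generated A)"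
  unfolding generated_def by (rule hull_in) (auto simp: add_submonoid_def)

lemma subset_generated: "A \<subseteq> generated A"
  unfolding generated_def by (rule hull_subset)

text \<open>The combinations supported on \<open>A\<close> form a submonoid that contains
  \<open>A\<close>. Restricting the support lets one family \<open>ns\<close> describe all the
  submonoids generated by subsets of it.\<close>

lemma generated_eq_combinations:
  assumes "A \<subseteq> set ns"
  shows "generated A = {combination ns p | p. \<forall>i<length ns. p i > 0 \<longrightarrow> ns ! i \<in> A}" (is "_ = ?C")
proof
  have "add_submonoid ?C"
    unfolding add_submonoid_def
  proof (intro conjI ballI)
    show "0 \<in> ?C"
      by (rule CollectI, rule exI[of _ "\<lambda>_. 0"]) simp
    fix x y assume "x \<in> ?C" "y \<in> ?C"
    then obtain p q where pq: "x = combination ns p" "\<forall>i<length ns. p i > 0 \<longrightarrow> ns ! i \<in> A"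
      "y = combination ns q" "\<forall>i<length ns. q i > 0 \<longrightarrow> ns ! i \<in> A" by blast
    show "x + y \<in> ?C"
      by (rule CollectI, rule exI[of _ "\<lambda>i. p i + q i"]) (use pq in \<open>auto simp: combination_add\<close>)
  qed
  moreover have "A \<subseteq> ?C"
  proof
    fix x assume "x \<in> A"
    then obtain i where i: "i < length ns" "x = ns ! i"
      using assms by (metis in_set_conv_nth subsetD)
    show "x \<in> ?C"
      by (rule CollectI, rule exI[of _ "\<lambda>j. of_bool (j = i)"])
        (use i \<open>x \<in> A\<close> in \<open>simp add: combination_unit\<close>)
  qed
  ultimately show "generated A \<subseteq> ?C"
    unfolding generated_def by (intro hull_minimal)
  show "?C \<subseteq> generated A"
    using combination_closed[OF add_submonoid_generated] subset_generated by blast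
qed

lemma generated_set: "generated (set ns) = range (combination ns)"
  by (subst generated_eq_combinations[OF order_refl]) auto

text \<open>If the other generators already produce \<open>x\<close>, then \<open>A - {x}\<close> is
  a proper subset that still generates \<open>T\<close>.\<close>

lemma minimally_generates_not_redundant:
  assumes "minimally_generates A T" "x \<in> A" "x \<in> generated (A - {x})"
  shows False
proof -
  have "A \<subseteq> generated (A - {x})"
    using assms(3) subset_generated[of "A - {x}"] by blast
  then have "generated A \<subseteq> generated (A - {x})"
    unfolding generated_def
    by (metis add_submonoid_generated generated_def hull_minimal)
  moreover have "generated (A - {x}) \<subseteq> generated A"
    unfolding generated_def by (rule hull_mono) blast
  ultimately have "generated (A - {x}) = T"
    using assms(1) by (auto simp: minimally_generates_def)
  moreover have "A - {x} \<subset> A" using assms(2) by blast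
  ultimately show False
    using assms(1) by (auto simp: minimally_generates_def)
qed

section \<open>Unique factorization of minimal generators\<close>

lemma combination_split:
  assumes "i < length ns" "p i > 0"
  shows "combination ns p = ns ! i + combination ns (p(i := p i - 1))"
proof -
  have "combination ns p = combination ns (\<lambda>j. of_bool (j = i) + (p(i := p i - 1)) j)"
    by (rule combination_cong) (use assms in auto)
  then show ?thesis by (simp only: combination_add combination_unit[OF assms(1)])
qed

text \<open>A factorization of a generator must use that generator, or else it would be redundant.
  Cancelling one copy leaves a factorization of 0, and reducedness makes all of its coefficients
  vanish.\<close>

lemma minimally_generates_indecomposable:
  assumes red: "reduced T" and canc: "cancellative T" and dist: "distinct ns"
    and gen: "minimally_generates (set ns) T"
  shows "indecomposable ns"
  unfolding indecomposable_def
proof (intro allI impI)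
  have T: "T = generated (set ns)" and T': "combination ns p \<in> T" for p
    using gen generated_set[of ns] by (auto simp: minimally_generates_def)
  have inT: "ns ! i \<in> T" if "i < length ns" for i
    using subset_generated[of "set ns"] that T by auto
  have zero_in: "0 \<in> generated A" for A
    using add_submonoid_generated[of A] by (simp add: add_submonoid_def)
  \<comment> \<open>A positive coefficient would make \<open>ns ! i\<close> invertible, hence 0 by
    reducedness; but 0 lies in every submonoid and so is a redundant generator.\<close>
  have zero: "p i = 0" if "combination ns p = 0" "i < length ns" for p i
  proof (rule ccontr)
    assume "p i \<noteq> 0"
    then have "ns ! i + combination ns (p(i := p i - 1)) = 0"
      using combination_split[of i ns p] that by simp
    then have "ns ! i = 0"
      using red inT[OF that(2)] T' unfolding reduced_def by blast
    then show False
      using minimally_generates_not_redundant[OF gen, of 0] zero_in that(2) nth_mem by metis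
  qed
  fix i j p assume i: "i < length ns" and p: "combination ns p = ns ! i" and j: "j < length ns"
  have "p i > 0"
  proof (rule ccontr)
    assume "\<not> p i > 0"
    \<comment> \<open>By distinctness, leaving out position \<open>i\<close> is the same as leaving
      out the element \<open>ns ! i\<close>.\<close>
    moreover from i dist have "ns ! k \<in> set ns - {ns ! i}" if "k < length ns" "k \<noteq> i" for k
      using that by (simp add: nth_eq_iff_index_eq)
    ultimately have "combination ns p \<in> generated (set ns - {ns ! i})"
      by (intro combination_closed[OF add_submonoid_generated] subsetD[OF subset_generated])
        (metis neq0_conv)
    then show False
      using minimally_generates_not_redundant[OF gen, of "ns ! i"] p i by simp
  qed
  then have "ns ! i + combination ns (p(i := p i - 1)) = ns ! i + 0"
    using combination_split[of i ns p] i p by simp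
  then have "combination ns (p(i := p i - 1)) = 0"
    using canc inT[OF i] T' T zero_in unfolding cancellative_def by blast
  from zero[OF this j] zero[OF this i] \<open>p i > 0\<close> show "p j = of_bool (j = i)"
    by (auto split: if_splits)
qed

lemma indecomposableD:
  "indecomposable ns \<Longrightarrow> i < length ns \<Longrightarrow> combination ns p = ns ! i \<Longrightarrow> j < length ns \<Longrightarrow>
    p j = of_bool (j = i)"
  by (simp add: indecomposable_def)

text \<open>Adding a factorization of 0 to the trivial factorization of \<open>ns ! i\<close> gives
  a factorization of \<open>ns ! i\<close> again, which has to be the trivial one.\<close>

lemma indecomposable_combination_zero:
  assumes "indecomposable ns" "combination ns p = 0" "i < length ns"
  shows "p i = 0"
proof -
  have "combination ns (\<lambda>j. of_bool (j = i) + p j) = ns ! i"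
    using assms by (simp only: combination_add combination_unit add_0_right)
  from indecomposableD[OF assms(1,3) this assms(3)] show ?thesis by simp
qed

text \<open>An element standing at two positions would have two different factorizations.\<close>

lemma indecomposable_distinct:
  assumes "indecomposable ns"
  shows "distinct ns"
  unfolding distinct_conv_nth
proof (intro allI impI notI)
  fix i j assume ij: "i < length ns" "j < length ns" "i \<noteq> j" "ns ! i = ns ! j"
  then have "combination ns (\<lambda>k. of_bool (k = j)) = ns ! i"
    by (simp add: combination_unit)
  from indecomposableD[OF assms ij(1) this ij(2)] ij(3) show False by simp
qed

text \<open>A generator outside \<open>A\<close> would be a combination with coefficient 0 at its
  own position, against the required coefficient 1.\<close>

lemma indecomposable_minimally_generates:
  assumes "indecomposable ns"
  shows "minimally_generates (set ns) (generated (set ns))"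
  unfolding minimally_generates_def
proof (intro conjI allI impI notI refl)
  fix A assume A: "A \<subset> set ns" "generated A = generated (set ns)"
  then obtain i where i: "i < length ns" "ns ! i \<notin> A"
    by (metis in_set_conv_nth psubset_imp_ex_mem DiffD1 DiffD2)
  have "ns ! i \<in> generated A"
    using A(2) subset_generated[of "set ns"] i(1) by auto
  moreover have "A \<subseteq> set ns" using A(1) by blast
  ultimately obtain p where p: "ns ! i = combination ns p" "\<forall>j<length ns. p j > 0 \<longrightarrow> ns ! j \<in> A"
    unfolding generated_eq_combinations[OF \<open>A \<subseteq> set ns\<close>] by blast
  from indecomposableD[OF assms i(1) p(1)[symmetric] i(1)] p(2) i show False by simp
qed

text \<open>Factorizations of two mutually inverse elements add up to a factorization of 0, so all
  their coefficients vanish.\<close>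

lemma indecomposable_reduced:
  assumes "indecomposable ns"
  shows "reduced (generated (set ns))"
proof -
  have "x = 0" if xy: "x \<in> generated (set ns)" "y \<in> generated (set ns)" "x + y = 0" for x y
  proof -
    obtain p q where pq: "x = combination ns p" "y = combination ns q"
      using xy(1,2) by (auto simp: generated_set)
    then have "combination ns (\<lambda>i. p i + q i) = 0"
      using xy(3) by (simp add: combination_add)
    from indecomposable_combination_zero[OF assms this] have "combination ns p = combination ns (\<lambda>_. 0)"
      by (intro combination_cong) simp
    with pq show ?thesis by simp
  qed
  moreover have "0 \<in> generated (set ns)"
    using add_submonoid_generated[of "set ns"] by (simp add: add_submonoid_def)
  moreover from this have "\<exists>y\<in>generated (set ns). 0 + y = 0" by auto
  ultimately show ?thesis
    unfolding reduced_def by blast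
qed

section \<open>Relation kernels and lattices\<close>

text \<open>The kernel compares the positive and the negative part of a difference, whereas
  \<open>p\<close> and \<open>q\<close> may overlap. Cancellation in \<open>T\<close> removes the
  overlap.\<close>

lemma relation_kernel_diff_iff:
  assumes canc: "cancellative T" and T: "generated (set ns) = T"
  shows "vec (length ns) (\<lambda>i. int (p i) - int (q i)) \<in> relation_kernel ns \<longleftrightarrow>
    combination ns p = combination ns q"
proof -
  \<comment> \<open>The common part of \<open>p\<close> and \<open>q\<close>; what remains on either
    side is a truncated difference.\<close>
  let ?m = "\<lambda>i. min (p i) (q i)"
  have "combination ns p = combination ns (\<lambda>i. ?m i + (p i - q i))"
    by (rule combination_cong) simp
  then have p: "combination ns p = combination ns ?m + combination ns (\<lambda>i. p i - q i)"
    by (simp only: combination_add)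
  have "combination ns q = combination ns (\<lambda>i. ?m i + (q i - p i))"
    by (rule combination_cong) simp
  then have q: "combination ns q = combination ns ?m + combination ns (\<lambda>i. q i - p i)"
    by (simp only: combination_add)
  have in_T: "combination ns f \<in> T" for f
    using T generated_set[of ns] by blast
  have "nat (int (p i) - int (q i)) = p i - q i" "nat (- (int (p i) - int (q i))) = q i - p i" for i
    by auto
  then have "vec (length ns) (\<lambda>i. int (p i) - int (q i)) \<in> relation_kernel ns \<longleftrightarrow>
    combination ns (\<lambda>i. p i - q i) = combination ns (\<lambda>i. q i - p i)"
    by (simp add: relation_kernel_def combination_def del: minus_diff_eq)
  also have "\<dots> \<longleftrightarrow> combination ns p = combination ns q"
  proof
    assume "combination ns p = combination ns q"
    then show "combination ns (\<lambda>i. p i - q i) = combination ns (\<lambda>i. q i - p i)"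
      using canc in_T unfolding p q cancellative_def by blast
  qed (simp add: p q)
  finally show ?thesis .
qed

section \<open>Lattices spanned by matrix rows\<close>

lemma in_lattice_of_rows_iff:
  fixes M :: "int mat"
  assumes M: "M \<in> carrier_mat k n"
  shows "x \<in> vec_module.lattice_of n (rows M) \<longleftrightarrow>
    x \<in> carrier_vec n \<and> (\<exists>c. \<forall>j<n. x $ j = (\<Sum>i<k. c i * M $$ (i, j)))"
proof -
  interpret vec_module "TYPE(int)" n .
  let ?comb = "\<lambda>c. sumlist (map (\<lambda>i. of_int (c i) \<cdot>\<^sub>v rows M ! i) [0..<length (rows M)])"
  have len: "length (rows M) = k" using M by simp
  have carr: "?comb c \<in> carrier_vec n" for c
    using M by (intro sumlist_carrier) auto
  have idx: "?comb c $ j = (\<Sum>i<k. c i * M $$ (i, j))" if "j < n" for c j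
    using M that by (subst sumlist_nth) (auto simp: atLeast0LessThan intro!: sum.cong)
  have "x = ?comb c \<longleftrightarrow> x \<in> carrier_vec n \<and> (\<forall>j<n. x $ j = (\<Sum>i<k. c i * M $$ (i, j)))" for c
    using carr[of c] idx[of _ c] by (auto intro!: eq_vecI)
  then show ?thesis unfolding lattice_of_def by blast
qed

text \<open>The number \<open>k\<close> is the coefficient of the last row of \<open>A\<close>. Once
  its multiple is subtracted, the zero blocks leave two independent conditions, one for
  \<open>L1\<close> and one for \<open>L2\<close>.\<close>

lemma in_lattice_of_gluing_iff:
  fixes L1 L2 :: "int mat" and f g :: "int vec"
  assumes L1: "L1 \<in> carrier_mat k1 r" and L2: "L2 \<in> carrier_mat k2 t"
    and f: "f \<in> carrier_vec r" and g: "g \<in> carrier_vec t"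
    and A: "A = four_block_mat L1 (0\<^sub>m k1 t) (0\<^sub>m k2 r) L2 @\<^sub>r mat_of_row (f @\<^sub>v - g)"
    and x: "x \<in> carrier_vec r" and y: "y \<in> carrier_vec t"
  shows "x @\<^sub>v y \<in> vec_module.lattice_of (r + t) (rows A) \<longleftrightarrow>
    (\<exists>k. x - k \<cdot>\<^sub>v f \<in> vec_module.lattice_of r (rows L1) \<and>
         y + k \<cdot>\<^sub>v g \<in> vec_module.lattice_of t (rows L2))"
proof -
  have A': "A \<in> carrier_mat (k1 + k2 + 1) (r + t)"
    using L1 L2 f g unfolding A by (intro carrier_append_rows) auto
  have dims: "dim_vec f = r" "dim_vec g = t" using f g by auto
  have split: "(\<Sum>i<k1 + k2 + 1. c i * A $$ (i, j)) =
     (\<Sum>i<k1. c i * A $$ (i, j)) + (\<Sum>i<k2. c (k1 + i) * A $$ (k1 + i, j)) +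
     c (k1 + k2) * A $$ (k1 + k2, j)" for c :: "nat \<Rightarrow> int" and j
  proof -
    have "(\<Sum>i<k1 + l. c i * A $$ (i, j)) =
       (\<Sum>i<k1. c i * A $$ (i, j)) + (\<Sum>i<l. c (k1 + i) * A $$ (k1 + i, j))" for l
      by (induction l) simp_all
    from this[of k2] show ?thesis by simp
  qed
  have left: "(\<Sum>i<k1 + k2 + 1. c i * A $$ (i, j)) =
      (\<Sum>i<k1. c i * L1 $$ (i, j)) + c (k1 + k2) * f $ j" if "j < r" for c :: "nat \<Rightarrow> int" and j
    unfolding split using that L1 L2 f g by (simp add: A append_rows_def)
  have right: "(\<Sum>i<k1 + k2 + 1. c i * A $$ (i, r + j)) =
      (\<Sum>i<k2. c (k1 + i) * L2 $$ (i, j)) - c (k1 + k2) * g $ j" if "j < t" for c :: "nat \<Rightarrow> int" and j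
    unfolding split using that L1 L2 f g by (simp add: A append_rows_def)
  have "(x @\<^sub>v y \<in> vec_module.lattice_of (r + t) (rows A)) \<longleftrightarrow>
    (\<exists>c. \<forall>j<r + t. (x @\<^sub>v y) $ j = (\<Sum>i<k1 + k2 + 1. c i * A $$ (i, j)))"
    using x y by (simp only: in_lattice_of_rows_iff[OF A']) simp
  also have "\<dots> \<longleftrightarrow> (\<exists>c. (\<forall>j<r. x $ j = (\<Sum>i<k1. c i * L1 $$ (i, j)) + c (k1 + k2) * f $ j) \<and>
      (\<forall>j<t. y $ j = (\<Sum>i<k2. c (k1 + i) * L2 $$ (i, j)) - c (k1 + k2) * g $ j))"
  proof -
    have all: "(\<forall>j<r + t. P j) \<longleftrightarrow> (\<forall>j<r. P j) \<and> (\<forall>j<t. P (r + j))" for P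
    proof safe
      fix j assume P: "\<forall>j<r. P j" "\<forall>j<t. P (r + j)" and "j < r + t"
      then show "P j" using spec[OF P(2), of "j - r"] by (cases "j < r") auto
    qed auto
    show ?thesis
      unfolding all using x y by (simp add: left right del: add_Suc_right One_nat_def)
  qed
  also have "\<dots> \<longleftrightarrow> (\<exists>c1 c2 k. (\<forall>j<r. x $ j = (\<Sum>i<k1. c1 i * L1 $$ (i, j)) + k * f $ j) \<and>
      (\<forall>j<t. y $ j = (\<Sum>i<k2. c2 i * L2 $$ (i, j)) - k * g $ j))" (is "?P \<longleftrightarrow> ?Q")
  proof
    assume ?P
    then obtain c where c: "(\<forall>j<r. x $ j = (\<Sum>i<k1. c i * L1 $$ (i, j)) + c (k1 + k2) * f $ j) \<and>
      (\<forall>j<t. y $ j = (\<Sum>i<k2. c (k1 + i) * L2 $$ (i, j)) - c (k1 + k2) * g $ j)" ..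
    show ?Q
      by (rule exI[of _ c], rule exI[of _ "\<lambda>i. c (k1 + i)"], rule exI[of _ "c (k1 + k2)"]) (fact c)
  next
    assume ?Q
    then obtain c1 c2 k where c: "\<forall>j<r. x $ j = (\<Sum>i<k1. c1 i * L1 $$ (i, j)) + k * f $ j"
      "\<forall>j<t. y $ j = (\<Sum>i<k2. c2 i * L2 $$ (i, j)) - k * g $ j" by blast
    show ?P
      \<comment> \<open>Rows are numbered block after block: \<open>c1\<close> takes the first
        \<open>k1\<close> places, \<open>c2\<close> the next \<open>k2\<close>, and \<open>k\<close>
        the place \<open>k1 + k2\<close> of the last row.\<close>
      by (rule exI[of _ "\<lambda>i. if i < k1 then c1 i else if i < k1 + k2 then c2 (i - k1) else k"])
        (use c in simp)
  qed
  also have "\<dots> \<longleftrightarrow> (\<exists>k. x - k \<cdot>\<^sub>v f \<in> vec_module.lattice_of r (rows L1) \<and>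
         y + k \<cdot>\<^sub>v g \<in> vec_module.lattice_of t (rows L2))"
    using x y f g
    by (simp add: in_lattice_of_rows_iff[OF L1] in_lattice_of_rows_iff[OF L2] algebra_simps) blast
  finally show ?thesis .
qed

text \<open>Translates the lattice condition on \<open>A\<close> into equations between natural
  combinations. The two disjuncts are the two signs of the multiplier of the last row; in each one
  the multiple is added on the side where it stays nonnegative.\<close>

lemma combination_gluing_iff:
  fixes as :: "'a::comm_monoid_add list" and bs :: "'b::comm_monoid_add list"
    and B1 B2 :: "'c::comm_monoid_add list" and L1 L2 A :: "int mat" and g h :: "nat vec"
  assumes as: "length as = r" "cancellative (generated (set as))"
    and bs: "length bs = t" "cancellative (generated (set bs))"
    and B: "length B1 = r" "length B2 = t" "cancellative (generated (set (B1 @ B2)))"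
    and L1: "L1 \<in> carrier_mat k1 r" "vec_module.lattice_of r (rows L1) = relation_kernel as"
    and L2: "L2 \<in> carrier_mat k2 t" "vec_module.lattice_of t (rows L2) = relation_kernel bs"
    and gh: "g \<in> carrier_vec r" "h \<in> carrier_vec t"
    and A: "A = four_block_mat L1 (0\<^sub>m k1 t) (0\<^sub>m k2 r) L2 @\<^sub>r
                mat_of_row (map_vec int g @\<^sub>v - map_vec int h)"
    and ker: "relation_kernel (B1 @ B2) = vec_module.lattice_of (r + t) (rows A)"
  shows "combination B1 p + combination B2 p' = combination B1 q + combination B2 q' \<longleftrightarrow>
    (\<exists>m. combination as p = combination as (\<lambda>i. q i + m * g $ i) \<and>
           combination bs (\<lambda>i. p' i + m * h $ i) = combination bs q' \<or>
         combination as (\<lambda>i. p i + m * g $ i) = combination as q \<and>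
           combination bs p' = combination bs (\<lambda>i. q' i + m * h $ i))"
proof -
  \<comment> \<open>Coefficients for \<open>B1\<close> and \<open>B2\<close> are joined into one
    function on the positions of \<open>B1 @ B2\<close>.\<close>
  let ?P = "\<lambda>i. if i < r then p i else p' (i - r)"
  let ?Q = "\<lambda>i. if i < r then q i else q' (i - r)"
  let ?x = "vec r (\<lambda>i. int (p i) - int (q i))" and ?y = "vec t (\<lambda>i. int (p' i) - int (q' i))"
  let ?f = "map_vec int g" and ?g = "map_vec int h"
  have eq: "combination (B1 @ B2) (\<lambda>i. if i < r then u i else v (i - r)) =
      combination B1 u + combination B2 v" for u v
    unfolding combination_append by (intro arg_cong2[of _ _ _ _ "(+)"] combination_cong) (use B in auto)
  have "combination B1 p + combination B2 p' = combination B1 q + combination B2 q' \<longleftrightarrow>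
      vec (r + t) (\<lambda>i. int (?P i) - int (?Q i)) \<in> relation_kernel (B1 @ B2)"
    using relation_kernel_diff_iff[OF B(3) refl, of ?P ?Q] B(1,2) by (simp only: eq length_append)
  also have "vec (r + t) (\<lambda>i. int (?P i) - int (?Q i)) = ?x @\<^sub>v ?y"
    by (intro eq_vecI) auto
  also have "?x @\<^sub>v ?y \<in> relation_kernel (B1 @ B2) \<longleftrightarrow>
      (\<exists>k. ?x - k \<cdot>\<^sub>v ?f \<in> relation_kernel as \<and> ?y + k \<cdot>\<^sub>v ?g \<in> relation_kernel bs)"
    unfolding ker by (subst in_lattice_of_gluing_iff[OF L1(1) L2(1) _ _ A]) (use gh L1(2) L2(2) in simp_all)
  also have "\<dots> \<longleftrightarrow> (\<exists>m. ?x - int m \<cdot>\<^sub>v ?f \<in> relation_kernel as \<and> ?y + int m \<cdot>\<^sub>v ?g \<in> relation_kernel bs \<or>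
      ?x - (- int m) \<cdot>\<^sub>v ?f \<in> relation_kernel as \<and> ?y + (- int m) \<cdot>\<^sub>v ?g \<in> relation_kernel bs)"
    (is "Ex ?K \<longleftrightarrow> _")
  proof -
    \<comment> \<open>Every integer is \<open>int m\<close> or \<open>- int m\<close> for a natural
      \<open>m\<close>.\<close>
    have "Ex K \<longleftrightarrow> (\<exists>m. K (int m) \<or> K (- int m))" for K
      by (metis int_cases2)
    then show ?thesis .
  qed
  also have "\<dots> \<longleftrightarrow> (\<exists>m. combination as p = combination as (\<lambda>i. q i + m * g $ i) \<and>
           combination bs (\<lambda>i. p' i + m * h $ i) = combination bs q' \<or>
         combination as (\<lambda>i. p i + m * g $ i) = combination as q \<and>
           combination bs p' = combination bs (\<lambda>i. q' i + m * h $ i))"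
  proof (intro arg_cong[of _ _ Ex] ext arg_cong2[of _ _ _ _ "(\<or>)"] arg_cong2[of _ _ _ _ "(\<and>)"])
    fix m
    note as_iff = relation_kernel_diff_iff[OF as(2) refl, unfolded as(1)]
    note bs_iff = relation_kernel_diff_iff[OF bs(2) refl, unfolded bs(1)]
    have "?x - int m \<cdot>\<^sub>v ?f = vec r (\<lambda>i. int (p i) - int (q i + m * g $ i))"
      using gh by (intro eq_vecI) auto
    then show "(?x - int m \<cdot>\<^sub>v ?f \<in> relation_kernel as) =
        (combination as p = combination as (\<lambda>i. q i + m * g $ i))"
      by (simp only: as_iff)
    have "?y + int m \<cdot>\<^sub>v ?g = vec t (\<lambda>i. int (p' i + m * h $ i) - int (q' i))"
      using gh by (intro eq_vecI) auto
    then show "(?y + int m \<cdot>\<^sub>v ?g \<in> relation_kernel bs) =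
        (combination bs (\<lambda>i. p' i + m * h $ i) = combination bs q')"
      by (simp only: bs_iff)
    have "?x - (- int m) \<cdot>\<^sub>v ?f = vec r (\<lambda>i. int (p i + m * g $ i) - int (q i))"
      using gh by (intro eq_vecI) auto
    then show "(?x - (- int m) \<cdot>\<^sub>v ?f \<in> relation_kernel as) =
        (combination as (\<lambda>i. p i + m * g $ i) = combination as q)"
      by (simp only: as_iff)
    have "?y + (- int m) \<cdot>\<^sub>v ?g = vec t (\<lambda>i. int (p' i) - int (q' i + m * h $ i))"
      using gh by (intro eq_vecI) auto
    then show "(?y + (- int m) \<cdot>\<^sub>v ?g \<in> relation_kernel bs) =
        (combination bs p' = combination bs (\<lambda>i. q' i + m * h $ i))"
      by (simp only: bs_iff)
  qed
  finally show ?thesis .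
qed

section \<open>Binomials in semigroup ideals\<close>

text \<open>The variables are the elements of \<open>ns\<close> themselves, so coefficients at
  repeated positions add up; only for a distinct family can they be recovered.\<close>

definition exponent :: "'v list \<Rightarrow> (nat \<Rightarrow> nat) \<Rightarrow> ('v \<Rightarrow>\<^sub>0 nat)" where
  "exponent ns p = (\<Sum>i<length ns. Poly_Mapping.single (ns ! i) (p i))"

lemma exponent_add: "exponent ns (\<lambda>i. p i + q i) = exponent ns p + exponent ns q"
  by (simp add: exponent_def single_add sum.distrib)

lemma exponent_zero [simp]: "exponent ns (\<lambda>_. 0) = 0"
  by (simp add: exponent_def)

lemma keys_exponent: "Poly_Mapping.keys (exponent ns p) \<subseteq> set ns"
  unfolding exponent_def by (rule order_trans[OF keys_sum]) auto

lemma lookup_exponent: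
  assumes "distinct ns" "i < length ns"
  shows "Poly_Mapping.lookup (exponent ns p) (ns ! i) = p i"
proof -
  have "Poly_Mapping.lookup (exponent ns p) (ns ! i) = (\<Sum>j<length ns. if j = i then p j else 0)"
    unfolding exponent_def lookup_sum
    by (intro sum.cong) (use assms in \<open>auto simp: lookup_single nth_eq_iff_index_eq\<close>)
  with assms(2) show ?thesis by simp
qed

lemma exponent_lookup:
  assumes "distinct ns" "Poly_Mapping.keys \<alpha> \<subseteq> set ns"
  shows "exponent ns (\<lambda>i. Poly_Mapping.lookup \<alpha> (ns ! i)) = \<alpha>" (is "?e = _")
proof (rule poly_mapping_eqI)
  fix x
  show "Poly_Mapping.lookup ?e x = Poly_Mapping.lookup \<alpha> x"
  proof (cases "x \<in> set ns")
    case True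
    then show ?thesis using assms(1) by (auto simp: in_set_conv_nth lookup_exponent)
  next
    case False
    then have "x \<notin> Poly_Mapping.keys ?e" "x \<notin> Poly_Mapping.keys \<alpha>"
      using keys_exponent[of ns] assms(2) by auto
    then show ?thesis by (simp add: in_keys_iff)
  qed
qed

lemma weight_superset:
  assumes "finite V" "Poly_Mapping.keys \<alpha> \<subseteq> V"
  shows "weight n \<alpha> = (\<Sum>i\<in>V. nat_scale (Poly_Mapping.lookup \<alpha> i) (n i))"
  unfolding weight_def by (rule sum.mono_neutral_left) (use assms in \<open>auto simp: in_keys_iff\<close>)

lemma weight_add: "weight n (\<alpha> + \<beta>) = weight n \<alpha> + weight n \<beta>"
proof -
  let ?V = "Poly_Mapping.keys \<alpha> \<union> Poly_Mapping.keys \<beta>"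
  have "Poly_Mapping.keys (\<alpha> + \<beta>) \<subseteq> ?V" by (rule keys_add)
  then show ?thesis
    by (simp add: weight_superset[of ?V] lookup_add nat_scale_add sum.distrib)
qed

text \<open>With \<open>n = id\<close> this turns equality of weights, which defines the semigroup
  ideal, into equality of combinations.\<close>

lemma weight_exponent: "weight n (exponent ns p) = combination (map n ns) p"
proof -
  have single: "weight n (Poly_Mapping.single x k) = nat_scale k (n x)" for x k
    by (simp add: weight_def)
  have "weight n (sum f {..<k}) = (\<Sum>i<k. weight n (f i))" for f and k :: nat
    by (induction k) (simp_all add: weight_add, simp add: weight_def)
  then show ?thesis by (simp add: exponent_def combination_def single)
qed

section \<open>Congruence of monomials modulo an ideal\<close>

lemma monomial_add: "monomial (\<alpha> + \<beta>) = monomial \<alpha> * monomial \<beta>"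
  by (simp add: monomial_def mult_single)

lemma monomial_eq_iff [simp]: "monomial \<alpha> = (monomial \<beta> :: ('v, 'k::field) mpoly) \<longleftrightarrow> \<alpha> = \<beta>"
  by (metis monomial_def lookup_single_eq lookup_single_not_eq zero_neq_one)

lemma monomial_in_poly_ring:
  "Poly_Mapping.keys \<alpha> \<subseteq> V \<Longrightarrow> monomial \<alpha> \<in> carrier (poly_ring V)"
  by (simp add: monomial_def)

lemma minus_in_poly_ring:
  "x \<in> carrier (poly_ring V) \<Longrightarrow> y \<in> carrier (poly_ring V) \<Longrightarrow> x - y \<in> carrier (poly_ring V)"
  using keys_diff[of x y] by auto

lemma ring_poly_ring: "ring (poly_ring V :: ('v, 'k::field) mpoly ring)"
  using cring_poly_ring by (rule cring.axioms)

lemma ideal_poly_ring_add: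
  "ideal J (poly_ring V) \<Longrightarrow> x \<in> J \<Longrightarrow> y \<in> J \<Longrightarrow> x + y \<in> J"
  using additive_subgroup.a_closed[OF ideal.axioms(1), of J "poly_ring V" x y] by simp

lemma ideal_poly_ring_mult:
  "ideal J (poly_ring V) \<Longrightarrow> x \<in> carrier (poly_ring V) \<Longrightarrow> y \<in> J \<Longrightarrow> x * y \<in> J"
  using ideal.I_l_closed[of J "poly_ring V" y x] by simp

lemma ideal_poly_ring_zero: "ideal J (poly_ring V) \<Longrightarrow> 0 \<in> J"
  using additive_subgroup.zero_closed[OF ideal.axioms(1), of J "poly_ring V"] by simp

lemma ideal_poly_ring_uminus:
  fixes J :: "('v, 'k::field) mpoly set"
  assumes J: "ideal J (poly_ring V)" and x: "x \<in> J"
  shows "- x \<in> J"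
proof -
  have "- 1 \<in> carrier (poly_ring V :: ('v, 'k) mpoly ring)" by simp
  from ideal_poly_ring_mult[OF J this x] show ?thesis by simp
qed

text \<open>The sum of the two binomials telescopes. With the next two lemmas, membership of a
  difference of monomials in \<open>J\<close> behaves as a congruence on exponents.\<close>

lemma binomial_ideal_trans:
  assumes "ideal J (poly_ring V)" "monomial \<alpha> - monomial \<beta> \<in> J" "monomial \<beta> - monomial \<delta> \<in> J"
  shows "monomial \<alpha> - monomial \<delta> \<in> J"
  using ideal_poly_ring_add[OF assms] by simp

lemma binomial_ideal_shift:
  assumes J: "ideal J (poly_ring V)" and "Poly_Mapping.keys \<delta> \<subseteq> V" and mem: "monomial \<alpha> - monomial \<beta> \<in> J"
  shows "monomial (\<delta> + \<alpha>) - monomial (\<delta> + \<beta>) \<in> J"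
  using ideal_poly_ring_mult[OF J monomial_in_poly_ring mem, of \<delta>] assms(2)
  by (simp add: monomial_add right_diff_distrib)

text \<open>Passes through \<beta> + \<alpha>': first \<alpha> is exchanged for \<beta>, then
  \<alpha>' for \<beta>'.\<close>

lemma binomial_ideal_add:
  assumes J: "ideal J (poly_ring V)"
    and keys: "Poly_Mapping.keys \<beta> \<subseteq> V" "Poly_Mapping.keys \<alpha>' \<subseteq> V"
    and mem: "monomial \<alpha> - monomial \<beta> \<in> J" "monomial \<alpha>' - monomial \<beta>' \<in> J"
  shows "monomial (\<alpha> + \<alpha>') - monomial (\<beta> + \<beta>') \<in> J"
  using binomial_ideal_trans[OF J binomial_ideal_shift[OF J keys(2) mem(1)], of "\<beta> + \<beta>'"]
    binomial_ideal_shift[OF J keys(1) mem(2)] by (simp add: add.commute)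

section \<open>Semigroup ideals\<close>

lemma semigroup_ideal_generators_subset:
  "{monomial \<alpha> - monomial \<beta> | \<alpha> \<beta>. Poly_Mapping.keys \<alpha> \<subseteq> V \<and> Poly_Mapping.keys \<beta> \<subseteq> V \<and>
     weight n \<alpha> = weight n \<beta>} \<subseteq> carrier (poly_ring V)"
  using minus_in_poly_ring monomial_in_poly_ring by blast

lemma ideal_semigroup_ideal: "ideal (semigroup_ideal K V n) (poly_ring V)"
  unfolding semigroup_ideal_def
  by (rule ring.genideal_ideal[OF ring_poly_ring semigroup_ideal_generators_subset])

lemma binomial_in_semigroup_ideal:
  assumes "Poly_Mapping.keys \<alpha> \<subseteq> V" "Poly_Mapping.keys \<beta> \<subseteq> V" "weight n \<alpha> = weight n \<beta>"
  shows "monomial \<alpha> - monomial \<beta> \<in> semigroup_ideal K V n"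
  using ring.genideal_self[OF ring_poly_ring semigroup_ideal_generators_subset] assms
  unfolding semigroup_ideal_def by blast

lemma semigroup_ideal_subset:
  fixes K :: "'k::field itself" and n :: "'v \<Rightarrow> 'a::comm_monoid_add"
  assumes "ideal J (poly_ring V)"
    and "\<And>\<alpha> \<beta>. Poly_Mapping.keys \<alpha> \<subseteq> V \<Longrightarrow> Poly_Mapping.keys \<beta> \<subseteq> V \<Longrightarrow> weight n \<alpha> = weight n \<beta> \<Longrightarrow>
      (monomial \<alpha> - monomial \<beta> :: ('v, 'k) mpoly) \<in> J"
  shows "semigroup_ideal K V n \<subseteq> J"
  unfolding semigroup_ideal_def
  by (rule ring.genideal_minimal[OF ring_poly_ring assms(1)]) (use assms(2) in blast)

text \<open>The two ideals live in different rings. The contraction of the larger one to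
  \<open>poly_ring V\<close> is an ideal there and contains all generating binomials of the smaller
  one.\<close>

lemma semigroup_ideal_mono:
  fixes K :: "'k::field itself" and V W :: "'v set"
  assumes "V \<subseteq> W"
  shows "semigroup_ideal K V n \<subseteq> semigroup_ideal K W n"
proof -
  let ?I = "semigroup_ideal K W n" and ?R = "poly_ring V :: ('v, 'k) mpoly ring"
  interpret ring ?R by (rule ring_poly_ring)
  note I = ideal_semigroup_ideal[of K W n]
  have sub: "carrier ?R \<subseteq> carrier (poly_ring W)" using assms by auto
  have uminus: "\<ominus>\<^bsub>?R\<^esub> x = - x" if "x \<in> carrier ?R" for x
    using that by (intro minus_equality) simp_all
  have "ideal (?I \<inter> carrier ?R) ?R"
  proof (rule idealI[OF ring_poly_ring])
    show "subgroup (?I \<inter> carrier ?R) (add_monoid ?R)"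
    proof (rule add.subgroupI)
      show "?I \<inter> carrier ?R \<noteq> {}" using ideal_poly_ring_zero[OF I] zero_closed by auto
      show "\<ominus>\<^bsub>?R\<^esub> x \<in> ?I \<inter> carrier ?R" if "x \<in> ?I \<inter> carrier ?R" for x
        using that ideal_poly_ring_uminus[OF I] a_inv_closed[of x] uminus[of x]
        by simp
      show "x \<oplus>\<^bsub>?R\<^esub> y \<in> ?I \<inter> carrier ?R"
        if "x \<in> ?I \<inter> carrier ?R" "y \<in> ?I \<inter> carrier ?R" for x y
        using that ideal_poly_ring_add[OF I, of x y] a_closed[of x y] by simp
    qed auto
    show mult: "x \<otimes>\<^bsub>?R\<^esub> a \<in> ?I \<inter> carrier ?R" if "a \<in> ?I \<inter> carrier ?R" "x \<in> carrier ?R" for a x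
      using that ideal_poly_ring_mult[OF I subsetD[OF sub], of x a] m_closed[of x a] by simp
    show "a \<otimes>\<^bsub>?R\<^esub> x \<in> ?I \<inter> carrier ?R" if "a \<in> ?I \<inter> carrier ?R" "x \<in> carrier ?R" for a x
      using mult[OF that] by (simp add: mult.commute)
  qed
  then have "semigroup_ideal K V n \<subseteq> ?I \<inter> carrier ?R"
  proof (rule semigroup_ideal_subset)
    fix \<alpha> \<beta> assume *: "Poly_Mapping.keys \<alpha> \<subseteq> V" "Poly_Mapping.keys \<beta> \<subseteq> V" "weight n \<alpha> = weight n \<beta>"
    then show "monomial \<alpha> - monomial \<beta> \<in> ?I \<inter> carrier ?R"
      using minus_in_poly_ring[OF monomial_in_poly_ring monomial_in_poly_ring]
        binomial_in_semigroup_ideal[of \<alpha> W \<beta> n K] assms by blast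
  qed
  then show ?thesis by blast
qed

section \<open>The gluing\<close>

text \<open>Keeps of the matrix \<open>A\<close> only the resulting description of equality in the
  glued semigroup. The assumptions are symmetric in the two sides, so that the right half of each
  argument comes from the left half.\<close>

locale gluing_pair =
  fixes as :: "'a::comm_monoid_add list" and bs :: "'b::comm_monoid_add list"
    and B1 B2 :: "'c::comm_monoid_add list" and g h :: "nat \<Rightarrow> nat"
  assumes indec: "indecomposable as" "indecomposable bs"
    and len: "length B1 = length as" "length B2 = length bs"
    and sums: "(\<Sum>i<length as. g i) > 1" "(\<Sum>i<length bs. h i) > 1"
    and combination_eq_iff:
      "combination B1 p + combination B2 p' = combination B1 q + combination B2 q' \<longleftrightarrow>
        (\<exists>m. combination as p = combination as (\<lambda>i. q i + m * g i) \<and>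
               combination bs (\<lambda>i. p' i + m * h i) = combination bs q' \<or>
             combination as (\<lambda>i. p i + m * g i) = combination as q \<and>
               combination bs p' = combination bs (\<lambda>i. q' i + m * h i))"
begin

text \<open>Exchanging the two families exchanges the two disjuncts of
  \<open>combination_eq_iff\<close>.\<close>

lemma swap: "gluing_pair bs as B2 B1 h g"
proof
  fix p p' q q'
  show "combination B2 p + combination B1 p' = combination B2 q + combination B1 q' \<longleftrightarrow>
        (\<exists>m. combination bs p = combination bs (\<lambda>i. q i + m * h i) \<and>
               combination as (\<lambda>i. p' i + m * g i) = combination as q' \<or>
             combination bs (\<lambda>i. p i + m * h i) = combination bs q \<and>
               combination as p' = combination as (\<lambda>i. q' i + m * g i))"
    using combination_eq_iff[of p' p q' q] by (simp only: add.commute) blast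
qed (use indec len sums in auto)

section \<open>Factorizations of generators in the glued family\<close>

lemma multiplier_zero:
  assumes "\<And>i. i < length bs \<Longrightarrow> p i + m * h i = 0"
  shows "m = 0"
proof (rule ccontr)
  assume "m \<noteq> 0"
  with assms have "(\<Sum>i<length bs. h i) = 0" by simp
  with sums(2) show False by simp
qed

text \<open>Comparison with the trivial factorization of \<open>B1 ! i\<close> yields a multiplier
  \<open>m\<close>. For one sign \<open>m * h\<close> is part of a factorization of 0 over
  \<open>bs\<close>; for the other \<open>m * g\<close> is part of a factorization of
  \<open>as ! i\<close>, which has only one term. Either way \<open>m = 0\<close>.\<close>

lemma left_generator_indecomposable:
  assumes i: "i < length as" and eq: "combination B1 p + combination B2 q = B1 ! i"
  shows "(\<forall>j<length as. p j = of_bool (j = i)) \<and> (\<forall>j<length bs. q j = 0)"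
proof -
  let ?e = "\<lambda>j. of_bool (j = i) :: nat"
  have "combination B1 p + combination B2 q = combination B1 ?e + combination B2 (\<lambda>_. 0)"
    using eq i len combination_unit[of i B1] by simp
  then obtain m where
    "combination as p = combination as (\<lambda>i. ?e i + m * g i) \<and>
       combination bs (\<lambda>i. q i + m * h i) = combination bs (\<lambda>_. 0) \<or>
     combination as (\<lambda>i. p i + m * g i) = combination as ?e \<and>
       combination bs q = combination bs (\<lambda>i. 0 + m * h i)"
    unfolding combination_eq_iff by blast
  then show ?thesis
  proof (elim disjE conjE)
    assume as: "combination as p = combination as (\<lambda>i. ?e i + m * g i)"
      and bs: "combination bs (\<lambda>i. q i + m * h i) = combination bs (\<lambda>_. 0)"
    have zero: "q j + m * h j = 0" if "j < length bs" for j
      using indecomposable_combination_zero[OF indec(2), of "\<lambda>i. q i + m * h i"] bs that by simp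
    with multiplier_zero have "m = 0" by blast
    then have "combination as p = as ! i" using as i by (simp add: combination_unit)
    with indecomposableD[OF indec(1) i this] zero show ?thesis by simp
  next
    assume as: "combination as (\<lambda>i. p i + m * g i) = combination as ?e"
      and bs: "combination bs q = combination bs (\<lambda>i. 0 + m * h i)"
    have unit: "p j + m * g j = of_bool (j = i)" if "j < length as" for j
      using indecomposableD[OF indec(1) i _ that, of "\<lambda>i. p i + m * g i"] as i
      by (simp add: combination_unit)
    \<comment> \<open>Counting terms: the unit vector has total 1, while \<open>g\<close> alone has
      total greater than 1.\<close>
    have "m * (\<Sum>j<length as. g j) \<le> (\<Sum>j<length as. p j + m * g j)"
      by (simp add: sum.distrib sum_distrib_left)
    also have "\<dots> = (\<Sum>j<length as. if j = i then 1 else 0)"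
      by (intro sum.cong) (auto simp: unit)
    also have "\<dots> = 1" using i by simp
    finally have "m = 0" using sums(1) by (cases m) auto
    then have "combination bs q = 0" using bs by simp
    from indecomposable_combination_zero[OF indec(2) this] unit \<open>m = 0\<close> show ?thesis by simp
  qed
qed

lemma indecomposable_append: "indecomposable (B1 @ B2)"
  unfolding indecomposable_def
proof (intro allI impI)
  interpret sw: gluing_pair bs as B2 B1 h g by (rule swap)
  fix i j p
  assume i: "i < length (B1 @ B2)" and eq: "combination (B1 @ B2) p = (B1 @ B2) ! i"
    and j: "j < length (B1 @ B2)"
  let ?p = "\<lambda>k. p (length as + k)"
  have j': "j - length as < length bs" if "\<not> j < length as"
    using j that len by simp
  have eq: "combination B1 p + combination B2 ?p = (B1 @ B2) ! i"
    using eq by (simp add: combination_append len)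
  show "p j = of_bool (j = i)"
  proof (cases "i < length as")
    case True
    then have "(\<forall>j<length as. p j = of_bool (j = i)) \<and> (\<forall>j<length bs. ?p j = 0)"
      using eq len by (intro left_generator_indecomposable) (auto simp: nth_append)
    then show ?thesis
      using True j' by (cases "j < length as") (auto dest!: spec[of _ "j - length as"])
  next
    case False
    then have "(\<forall>j<length bs. ?p j = of_bool (j = i - length as)) \<and> (\<forall>j<length as. p j = 0)"
      using eq len i by (intro sw.left_generator_indecomposable) (auto simp: nth_append add.commute)
    \<comment> \<open>Truncated subtraction loses nothing here, since neither index lies below
      \<open>length as\<close>.\<close>
    moreover have "j - length as = i - length as \<longleftrightarrow> j = i" if "\<not> j < length as"
      using False that by auto
    ultimately show ?thesis
      using False j' by (cases "j < length as") (auto dest!: spec[of _ "j - length as"])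
  qed
qed

section \<open>The ideal of the glued semigroup\<close>

lemma combination_left_eq:
  assumes "combination as p = combination as q"
  shows "combination B1 p = combination B1 q"
proof -
  have "combination B1 p + combination B2 (\<lambda>_. 0) = combination B1 q + combination B2 (\<lambda>_. 0)"
    unfolding combination_eq_iff by (rule exI[of _ 0]) (use assms in simp)
  then show ?thesis by simp
qed

text \<open>The relation given by the last row of \<open>A\<close>, taken once. It puts the gluing
  binomial into the ideal of the glued semigroup.\<close>

lemma combination_gluing: "combination B1 g = combination B2 h"
proof -
  have "combination B1 g + combination B2 (\<lambda>_. 0) = combination B1 (\<lambda>_. 0) + combination B2 h"
    unfolding combination_eq_iff by (rule exI[of _ 1]) simp
  then show ?thesis by simp
qed

text \<open>Congruences can be added, so \<open>m\<close> copies of the gluing binomial combine into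
  one binomial by induction.\<close>

lemma multiples_in_ideal:
  assumes J: "ideal J (poly_ring V)" and V: "set B1 \<subseteq> V" "set B2 \<subseteq> V"
    and f: "monomial (exponent B1 g) - monomial (exponent B2 h) \<in> J"
  shows "monomial (exponent B1 (\<lambda>i. m * g i)) - monomial (exponent B2 (\<lambda>i. m * h i)) \<in> J"
proof (induction m)
  case 0
  show ?case using ideal_poly_ring_zero[OF J] by simp
next
  case (Suc m)
  have "Poly_Mapping.keys (exponent B2 h) \<subseteq> V" "Poly_Mapping.keys (exponent B1 (\<lambda>i. m * g i)) \<subseteq> V"
    using keys_exponent V by (meson order_trans)+
  from binomial_ideal_add[OF J this f Suc] show ?case by (simp add: exponent_add)
qed

text \<open>
  A relation with multiplier \<open>m\<close> is a chain of three congruences: a relation of the left family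
  turns \<open>X^p\<close> into \<open>X^(q + m g)\<close>, the gluing binomial exchanges \<open>X^(m g)\<close> for \<open>Y^(m h)\<close>, and a
  relation of the right family turns \<open>Y^(p' + m h)\<close> into \<open>Y^q'\<close>.
\<close>

lemma relation_in_ideal:
  assumes J: "ideal J (poly_ring V)" and V: "set B1 \<subseteq> V" "set B2 \<subseteq> V"
    and left: "\<And>p q. combination as p = combination as q \<Longrightarrow>
      monomial (exponent B1 p) - monomial (exponent B1 q) \<in> J"
    and right: "\<And>p q. combination bs p = combination bs q \<Longrightarrow>
      monomial (exponent B2 p) - monomial (exponent B2 q) \<in> J"
    and f: "monomial (exponent B1 g) - monomial (exponent B2 h) \<in> J"
    and as: "combination as p = combination as (\<lambda>i. q i + m * g i)"
    and bs: "combination bs (\<lambda>i. p' i + m * h i) = combination bs q'"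
  shows "monomial (exponent B1 p + exponent B2 p') - monomial (exponent B1 q + exponent B2 q') \<in> J"
proof -
  have keys: "Poly_Mapping.keys (exponent B1 u) \<subseteq> V" "Poly_Mapping.keys (exponent B2 u) \<subseteq> V" for u
    using keys_exponent V by (meson order_trans)+
  have keys_sum: "Poly_Mapping.keys (exponent B1 u + exponent B2 v) \<subseteq> V" for u v
    using Poly_Mapping.keys_add keys by (meson Un_least order_trans)
  let ?g = "exponent B1 (\<lambda>i. m * g i)" and ?h = "exponent B2 (\<lambda>i. m * h i)"
  have "monomial (exponent B1 p + exponent B2 p') -
      monomial (exponent B1 q + exponent B2 p' + ?g) \<in> J"
    using binomial_ideal_shift[OF J keys(2) left[OF as], of p']
    by (simp add: exponent_add add_ac)
  moreover have "monomial (exponent B1 q + exponent B2 p' + ?g) -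
      monomial (exponent B1 q + exponent B2 p' + ?h) \<in> J"
    by (rule binomial_ideal_shift[OF J keys_sum multiples_in_ideal[OF J V f]])
  moreover have "monomial (exponent B1 q + exponent B2 p' + ?h) -
      monomial (exponent B1 q + exponent B2 q') \<in> J"
    using binomial_ideal_shift[OF J keys(1) right[OF bs], of q]
    by (simp add: exponent_add add_ac)
  ultimately show ?thesis
    by (rule binomial_ideal_trans[OF J binomial_ideal_trans[OF J]])
qed

text \<open>The three summands lie in \<open>?I\<close> by monotonicity and by
  \<open>combination_gluing\<close>. Conversely, each generating binomial of \<open>?I\<close> comes
  from a relation with some multiplier, and \<open>relation_in_ideal\<close> places it in the
  sum.\<close>

lemma semigroup_ideal_gluing:
  fixes K :: "'k::field itself"
  defines "V \<equiv> set B1 \<union> set B2"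
  defines "R \<equiv> poly_ring V :: ('c, 'k) mpoly ring"
  defines "f \<equiv> monomial (exponent B1 g) - monomial (exponent B2 h)"
  shows "f \<in> semigroup_ideal K V id"
    and "semigroup_ideal K V id =
      genideal R (semigroup_ideal K (set B1) id) <+>\<^bsub>R\<^esub>
      genideal R (semigroup_ideal K (set B2) id) <+>\<^bsub>R\<^esub> genideal R {f}" (is "?I = ?J")
proof -
  interpret sw: gluing_pair bs as B2 B1 h g by (rule swap)
  interpret R: ring R unfolding R_def by (rule ring_poly_ring)
  let ?I1 = "semigroup_ideal K (set B1) id" and ?I2 = "semigroup_ideal K (set B2) id"
  have V: "set B1 \<subseteq> V" "set B2 \<subseteq> V" by (auto simp: V_def)
  have I: "ideal ?I R" unfolding R_def by (rule ideal_semigroup_ideal)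
  have I_sub: "?I \<subseteq> carrier R"
    by (rule additive_subgroup.a_subset[OF ideal.axioms(1)[OF I]])
  have sub: "?I1 \<subseteq> ?I" "?I2 \<subseteq> ?I" using semigroup_ideal_mono V by blast+
  have keys: "Poly_Mapping.keys (exponent B1 u) \<subseteq> V" "Poly_Mapping.keys (exponent B2 u) \<subseteq> V" for u
    using keys_exponent V by (meson order_trans)+
  show f: "f \<in> ?I"
    unfolding f_def
    by (intro binomial_in_semigroup_ideal keys) (simp add: weight_exponent combination_gluing)
  let ?G1 = "genideal R ?I1" and ?G2 = "genideal R ?I2" and ?G3 = "genideal R {f}"
  have G: "ideal ?G1 R" "ideal ?G2 R" "ideal ?G3 R"
    using sub I_sub f by (blast intro!: R.genideal_ideal)+
  have G_sub: "?G1 \<subseteq> ?I" "?G2 \<subseteq> ?I" "?G3 \<subseteq> ?I"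
    using sub f by (auto intro!: R.genideal_minimal[OF I])
  have G_gen: "?I1 \<subseteq> ?G1" "?I2 \<subseteq> ?G2" "f \<in> ?G3"
    using sub I_sub f by (blast intro!: R.genideal_self R.genideal_self')+
  have J: "ideal ?J R" using R.add_ideals G by blast
  have set_add: "x \<in> A <+>\<^bsub>R\<^esub> B \<longleftrightarrow> (\<exists>a\<in>A. \<exists>b\<in>B. x = a + b)" for x A B
    by (auto simp: set_add_def' R_def)
  have zero: "0 \<in> ?G1" "0 \<in> ?G2" "0 \<in> ?G3"
    using G unfolding R_def by (simp_all only: ideal_poly_ring_zero)
  \<comment> \<open>Each summand embeds in the sum by adding 0 from the other one.\<close>
  have summand: "x \<in> A <+>\<^bsub>R\<^esub> B" if "x \<in> A \<and> 0 \<in> B \<or> 0 \<in> A \<and> x \<in> B" for x A B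
    unfolding set_add using that by force
  have G_J: "x \<in> ?J" if "x \<in> ?G1 \<or> x \<in> ?G2 \<or> x \<in> ?G3" for x
    using that zero by (intro summand) (blast intro: summand)
  show "?I = ?J"
  proof
    show "?J \<subseteq> ?I"
    proof
      fix x assume "x \<in> ?J"
      then obtain y c where y: "y \<in> ?G1 <+>\<^bsub>R\<^esub> ?G2" and c: "c \<in> ?G3" "x = y + c"
        unfolding set_add[of x] by blast
      from y obtain a b where "a \<in> ?G1" "b \<in> ?G2" "y = a + b"
        unfolding set_add by blast
      with c have abc: "a \<in> ?G1" "b \<in> ?G2" "c \<in> ?G3" and x: "x = a + b + c" by simp_all
      show "x \<in> ?I"
        unfolding x by (intro ideal_poly_ring_add[OF I[unfolded R_def]]) (use abc G_sub in auto)
    qed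
    have JR: "ideal ?J (poly_ring V)" using J by (simp only: R_def)
    have left: "monomial (exponent B1 p) - monomial (exponent B1 q) \<in> ?J"
      if "combination as p = combination as q" for p q
      using combination_left_eq[OF that] G_gen(1)
      by (intro G_J disjI1 subsetD[OF G_gen(1)] binomial_in_semigroup_ideal keys_exponent)
        (simp add: weight_exponent)
    have right: "monomial (exponent B2 p) - monomial (exponent B2 q) \<in> ?J"
      if "combination bs p = combination bs q" for p q
      using sw.combination_left_eq[OF that] G_gen(2)
      by (intro G_J disjI2[OF disjI1] subsetD[OF G_gen(2)] binomial_in_semigroup_ideal keys_exponent)
        (simp add: weight_exponent)
    have fJ: "monomial (exponent B1 g) - monomial (exponent B2 h) \<in> ?J"
      using G_J G_gen(3) unfolding f_def by blast
    \<comment> \<open>Positions and variables now correspond, so any exponent over \<open>V\<close>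
      can be read off as a coefficient function and cut into its two halves.\<close>
    have dist: "distinct (B1 @ B2)"
      by (rule indecomposable_distinct[OF indecomposable_append])
    show "?I \<subseteq> ?J"
    proof (rule semigroup_ideal_subset[OF JR])
      fix \<alpha> \<beta> :: "'c \<Rightarrow>\<^sub>0 nat"
      assume keys_V: "Poly_Mapping.keys \<alpha> \<subseteq> V" "Poly_Mapping.keys \<beta> \<subseteq> V"
        and weights: "weight id \<alpha> = weight id \<beta>"
      have split: "\<exists>u v. \<delta> = exponent B1 u + exponent B2 v" if "Poly_Mapping.keys \<delta> \<subseteq> V" for \<delta>
      proof -
        have "exponent (B1 @ B2) w = exponent B1 w + exponent B2 (\<lambda>i. w (length B1 + i))" for w
        proof -
          have "(\<Sum>i<length B1 + n. Poly_Mapping.single ((B1 @ B2) ! i) (w i)) =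
              (\<Sum>i<length B1. Poly_Mapping.single (B1 ! i) (w i)) +
              (\<Sum>i<n. Poly_Mapping.single (B2 ! i) (w (length B1 + i)))" for n
            by (induction n) (simp_all add: add_ac nth_append)
          then show ?thesis by (simp add: exponent_def)
        qed
        then show ?thesis
          using exponent_lookup[OF dist, of \<delta>] that unfolding V_def by (metis set_append)
      qed
      from split keys_V obtain p p' q q' where
        pq: "\<alpha> = exponent B1 p + exponent B2 p'" "\<beta> = exponent B1 q + exponent B2 q'" by blast
      have "combination B1 p + combination B2 p' = combination B1 q + combination B2 q'"
        using weights by (simp add: pq weight_add weight_exponent)
      then obtain m where
        "combination as p = combination as (\<lambda>i. q i + m * g i) \<and>
           combination bs (\<lambda>i. p' i + m * h i) = combination bs q' \<or>
         combination as q = combination as (\<lambda>i. p i + m * g i) \<and>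
           combination bs (\<lambda>i. q' i + m * h i) = combination bs p'"
        unfolding combination_eq_iff by metis
      then show "monomial \<alpha> - monomial \<beta> \<in> ?J"
      proof (elim disjE conjE)
        assume "combination as p = combination as (\<lambda>i. q i + m * g i)"
          "combination bs (\<lambda>i. p' i + m * h i) = combination bs q'"
        from relation_in_ideal[OF JR V left right fJ this] show ?thesis by (simp add: pq)
      next
        assume "combination as q = combination as (\<lambda>i. p i + m * g i)"
          "combination bs (\<lambda>i. q' i + m * h i) = combination bs p'"
        \<comment> \<open>For the opposite sign the chain of congruences runs from \<beta> to
          \<alpha>, so the binomial appears negated.\<close>
        from ideal_poly_ring_uminus[OF JR relation_in_ideal[OF JR V left right fJ this]]
        show ?thesis by (simp add: pq)
      qed
    qed
  qed
qed

text \<open>Apart from cancellativity, which is assumed, the conditions follow from unique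
  factorization over \<open>B1 @ B2\<close> and from the splitting of the ideal.\<close>

lemma glued_semigroup_generated:
  assumes canc: "cancellative (generated (set (B1 @ B2)))"
  shows "glued_semigroup TYPE('k::field) (generated (set (B1 @ B2)))"
proof -
  have dist: "distinct (B1 @ B2)"
    by (rule indecomposable_distinct[OF indecomposable_append])
  have ne: "B1 \<noteq> []" "B2 \<noteq> []" using sums len by auto
  \<comment> \<open>The binomial is nonzero because \<open>g\<close> has a nonzero entry, whose
    variable belongs to \<open>B1\<close> and therefore cannot occur on the side of
    \<open>B2\<close>.\<close>
  have "exponent B1 g \<noteq> exponent B2 h"
  proof
    assume eq: "exponent B1 g = exponent B2 h"
    obtain i where i: "i < length as" "g i \<noteq> 0"
      using sums(1) by (metis lessThan_iff not_less_zero sum.neutral)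
    have "B1 ! i \<in> Poly_Mapping.keys (exponent B1 g)"
      using i dist len by (simp add: in_keys_iff lookup_exponent)
    then have "B1 ! i \<in> set B2" using eq keys_exponent[of B2 h] by auto
    moreover have "B1 ! i \<in> set B1" using i len by simp
    ultimately show False using dist by auto
  qed
  then have f: "monomial (exponent B1 g) - monomial (exponent B2 h) \<noteq> (0 :: ('c, 'k) mpoly)"
    by simp
  \<comment> \<open>Fixes the exponents of the gluing binomial as the witnesses in the definition of
    a gluing.\<close>
  have witnesses: "P (exponent B1 g) (exponent B2 h) \<Longrightarrow> \<exists>\<gamma> \<gamma>'. P \<gamma> \<gamma>'" for P
    by blast
  have "is_gluing TYPE('k) (generated (set (B1 @ B2))) (set B1) (set B2)"
    unfolding is_gluing_def Let_def
  proof (intro conjI witnesses)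
    show "finitely_generated (generated (set (B1 @ B2)))"
      unfolding finitely_generated_def by blast
    show "reduced (generated (set (B1 @ B2)))"
      by (rule indecomposable_reduced[OF indecomposable_append])
    show "minimally_generates (set B1 \<union> set B2) (generated (set (B1 @ B2)))"
      using indecomposable_minimally_generates[OF indecomposable_append] by simp
    show "Poly_Mapping.keys (exponent B1 g) \<subseteq> set B1" "Poly_Mapping.keys (exponent B2 h) \<subseteq> set B2"
      by (rule keys_exponent)+
    let ?R = "poly_ring (set B1 \<union> set B2) :: ('c, 'k) mpoly ring"
      and ?f = "monomial (exponent B1 g) - monomial (exponent B2 h) :: ('c, 'k) mpoly"
    show "?f \<noteq> 0" by (rule f)
    show "?f \<in> semigroup_ideal TYPE('k) (set B1 \<union> set B2) id"
      by (rule semigroup_ideal_gluing)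
    show "semigroup_ideal TYPE('k) (set B1 \<union> set B2) id =
        genideal ?R (semigroup_ideal TYPE('k) (set B1) id) <+>\<^bsub>?R\<^esub>
        genideal ?R (semigroup_ideal TYPE('k) (set B2) id) <+>\<^bsub>?R\<^esub> genideal ?R {?f}"
      by (rule semigroup_ideal_gluing)
  qed (use dist ne canc in simp_all)
  then show ?thesis unfolding glued_semigroup_def by blast
qed

end

theorem corollary10:
  fixes T1 :: "'a::comm_monoid_add set" and T2 :: "'b::comm_monoid_add set"
    and S :: "'c::comm_monoid_add set"
    and as :: "'a list" and bs :: "'b list" and B1 B2 :: "'c list"
    and r t k1 k2 :: nat
    and L1 L2 A :: "int mat" and \<gamma>X \<gamma>Y :: "nat vec"
  assumes T1: "finitely_generated T1" "reduced T1" "cancellative T1"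
    and A1: "length as = r" "distinct as" "minimally_generates (set as) T1"
    and I1: "semigroup_ideal TYPE('k::field) {..<r} ((!) as) \<noteq> {0}"
      "semigroup_ideal TYPE('k) {..<r} ((!) as) \<noteq> carrier (poly_ring {..<r})"
    and T2: "finitely_generated T2" "reduced T2" "cancellative T2"
    and A2: "length bs = t" "distinct bs" "minimally_generates (set bs) T2"
    and I2: "semigroup_ideal TYPE('k) {..<t} ((!) bs) \<noteq> {0}"
      "semigroup_ideal TYPE('k) {..<t} ((!) bs) \<noteq> carrier (poly_ring {..<t})"
    and L1: "L1 \<in> carrier_mat k1 r" "lattice_basis r (rows L1) (relation_kernel as)"
    and L2: "L2 \<in> carrier_mat k2 t" "lattice_basis t (rows L2) (relation_kernel bs)"
    and \<gamma>X: "\<gamma>X \<in> carrier_vec r" "\<gamma>X \<noteq> 0\<^sub>v r"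
    and \<gamma>Y: "\<gamma>Y \<in> carrier_vec t" "\<gamma>Y \<noteq> 0\<^sub>v t"
    and A: "A = four_block_mat L1 (0\<^sub>m k1 t) (0\<^sub>m k2 r) L2 @\<^sub>r
                mat_of_row (map_vec int \<gamma>X @\<^sub>v - map_vec int \<gamma>Y)"
    and B: "length B1 = r" "length B2 = t"
    and S: "cancellative S" "generated (set (B1 @ B2)) = S"
    and kerS: "relation_kernel (B1 @ B2) = vec_module.lattice_of (r + t) (rows A)"
    and sums: "(\<Sum>i<r. \<gamma>X $ i) > 1" "(\<Sum>i<t. \<gamma>Y $ i) > 1"
  shows "glued_semigroup TYPE('k) S"
proof -
  have gen: "generated (set as) = T1" "generated (set bs) = T2"
    using A1(3) A2(3) by (simp_all add: minimally_generates_def)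
  have lat: "vec_module.lattice_of r (rows L1) = relation_kernel as"
    "vec_module.lattice_of t (rows L2) = relation_kernel bs"
    using L1(2) L2(2) by (simp_all add: lattice_basis_def)
  \<comment> \<open>The entries of \<open>\<gamma>X\<close> and \<open>\<gamma>Y\<close> serve as
    the functions \<open>g\<close> and \<open>h\<close>.\<close>
  have "gluing_pair as bs B1 B2 (($) \<gamma>X) (($) \<gamma>Y)"
  proof
    show "indecomposable as" "indecomposable bs"
      using minimally_generates_indecomposable T1 T2 A1 A2 by blast+
    fix p p' q q'
    show "combination B1 p + combination B2 p' = combination B1 q + combination B2 q' \<longleftrightarrow>
      (\<exists>m. combination as p = combination as (\<lambda>i. q i + m * \<gamma>X $ i) \<and>
             combination bs (\<lambda>i. p' i + m * \<gamma>Y $ i) = combination bs q' \<or>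
           combination as (\<lambda>i. p i + m * \<gamma>X $ i) = combination as q \<and>
             combination bs p' = combination bs (\<lambda>i. q' i + m * \<gamma>Y $ i))"
      by (rule combination_gluing_iff[OF A1(1) _ A2(1) _ B _ L1(1) lat(1) L2(1) lat(2) \<gamma>X(1) \<gamma>Y(1) A kerS])
        (use gen S T1(3) T2(3) in simp_all)
  qed (use A1(1) A2(1) B sums in simp_all)
  from gluing_pair.glued_semigroup_generated[OF this] show ?thesis using S by simp
qed

end
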